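(* Let $G$ be a graph on $n$ vertices. Then $c_G(\mathfrak m)\ge n$.
   Context: Let $G$ be a finite simple graph on the vertex set $[n]=\{1,\dots,n\}$, let $K$ be a field, $S=K[x_1,\dots,x_n,y_1,\dots,y_n]$ and $\mathfrak m=(x_1,\dots,x_n,y_1,\dots,y_n)$. The binomial edge ideal of $G$ is $J_G=(x_iy_j-x_jy_i : \{i,j\}\in E(G))\subset S$. For a positive integer $k$ put $\mathfrak m^{[k]}=(x_1^k,\dots,x_n^k,y_1^k,\dots,y_n^k)$, $(\mathfrak m^{[k]},J_G)=\mathfrak m^{[k]}+J_G$, $v_G(k)=\max\{r\in\mathbb N : \mathfrak m^r\not\subseteq(\mathfrak m^{[k]},J_G)\}$, and $c_G(\mathfrak m)=\lim_{k\to\infty} v_G(k)/k$ (the diagonal $F$-threshold of $S/J_G$). *)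

theory Defs
  imports Complex_Main "HOL-Library.Poly_Mapping" "HOL-Library.Cardinality"
begin

section \<open>Finite simple graphs\<close>

text \<open>The vertex set is the finite type \<open>'v\<close>, so the number of vertices is \<open>CARD('v)\<close>;
  a graph is given by its set of edges.\<close>

definition simple_graph :: "'v::finite set set \<Rightarrow> bool" where
  "simple_graph E \<longleftrightarrow> (\<forall>e\<in>E. card e = 2)"


section \<open>The polynomial ring\<close>

datatype 'v variable = X 'v | Y 'v

text \<open>Polynomials are finitely supported functions from exponent vectors to coefficients.
  The variables are exactly \<open>X i\<close> and \<open>Y i\<close> for \<open>i :: 'v\<close>.\<close>

type_synonym ('v, 'k) S = "('v variable \<Rightarrow>\<^sub>0 nat) \<Rightarrow>\<^sub>0 'k"

definition var :: "'v variable \<Rightarrow> ('v, 'k::field) S" where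
  "var z = Poly_Mapping.single (Poly_Mapping.single z 1) 1"

abbreviation xvar :: "'v \<Rightarrow> ('v, 'k::field) S" where "xvar i \<equiv> var (X i)"
abbreviation yvar :: "'v \<Rightarrow> ('v, 'k::field) S" where "yvar i \<equiv> var (Y i)"


section \<open>Ideals\<close>

text \<open>The ideal generated by \<open>B\<close> is the span of \<open>B\<close> in the ring regarded as a module over itself.\<close>

definition ideal_gen :: "'a::comm_ring_1 set \<Rightarrow> 'a set" where
  "ideal_gen B = module.span (*) B"

definition ideal_sum :: "'a::comm_ring_1 set \<Rightarrow> 'a set \<Rightarrow> 'a set" where
  "ideal_sum I J = {a + b | a b. a \<in> I \<and> b \<in> J}"

definition ideal_mult :: "'a::comm_ring_1 set \<Rightarrow> 'a set \<Rightarrow> 'a set" where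
  "ideal_mult I J = ideal_gen {a * b | a b. a \<in> I \<and> b \<in> J}"

primrec ideal_power :: "'a::comm_ring_1 set \<Rightarrow> nat \<Rightarrow> 'a set" where
  "ideal_power I 0 = UNIV"
| "ideal_power I (Suc r) = ideal_mult I (ideal_power I r)"


section \<open>Binomial edge ideals and the diagonal F-threshold\<close>

definition max_ideal :: "('v::finite, 'k::field) S set" where
  "max_ideal = ideal_gen (range xvar \<union> range yvar)"

definition max_ideal_bracket :: "nat \<Rightarrow> ('v::finite, 'k::field) S set" where
  "max_ideal_bracket k = ideal_gen (range (\<lambda>i. xvar i ^ k) \<union> range (\<lambda>i. yvar i ^ k))"

definition binomial_edge_ideal :: "'v::finite set set \<Rightarrow> ('v, 'k::field) S set" where
  "binomial_edge_ideal E = ideal_gen {xvar i * yvar j - xvar j * yvar i | i j. {i, j} \<in> E}"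

text \<open>The type argument carries the coefficient field, which \<open>E\<close> does not determine.
  For \<open>k \<ge> 1\<close> the set is nonempty (it contains 0) and bounded, because
  every monomial of degree greater than \<open>2 * CARD('v) * (k - 1)\<close> is divisible by the \<open>k\<close>-th power of a
  variable; hence \<open>Max\<close> is the genuine maximum. The value at \<open>k = 0\<close> is irrelevant to the
  limit below.\<close>

definition v_graph :: "'k::field itself \<Rightarrow> 'v::finite set set \<Rightarrow> nat \<Rightarrow> nat" where
  "v_graph K E k = Max {r. \<not> ideal_power (max_ideal :: ('v, 'k) S set) r
                           \<subseteq> ideal_sum (max_ideal_bracket k) (binomial_edge_ideal E)}"

text \<open>\<open>lim\<close> is only specified for convergent sequences. This sequence does converge: modulo the
  binomial edge ideal, monomials multiply as in a commutative monoid, and replacing monomials by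
  their \<open>m\<close>-th powers gives, with \<open>N = 2 * CARD('v) + 1\<close>,
  \<open>v_graph K E (k * m) + N \<le> m * (v_graph K E k + N)\<close> for \<open>k, m \<ge> 1\<close>; as \<open>v_graph K E\<close> is monotone for \<open>k \<ge> 1\<close>, the limit
  exists.\<close>

definition diagonal_F_threshold :: "'k::field itself \<Rightarrow> 'v::finite set set \<Rightarrow> real" where
  "diagonal_F_threshold K E = lim (\<lambda>k. real (v_graph K E k) / real k)"

end

theory Submission
  imports Defs
begin

text \<open>Setting \<open>x\<^sub>i = y\<^sub>i\<close> kills \<open>J\<^sub>G\<close>, so the monomial \<open>(x\<^sub>1\<cdots>x\<^sub>n)\<^bsup>k-1\<^esup>\<close> witnesses \<open>v\<^sub>G(k) \<ge> n(k - 1)\<close>.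
  The limit exists because \<open>z \<mapsto> z\<^sup>m\<close> sends \<open>(\<mm>\<^bsup>[k]\<^esup>, J\<^sub>G)\<close> into \<open>(\<mm>\<^bsup>[km]\<^esup>, J\<^sub>G)\<close>: if all monomials
  of degree \<open>r\<close> lie in the former, so do their \<open>m\<close>-th powers in the latter, and every monomial of degree at
  least \<open>mr + 2n(m - 1)\<close> is divisible by such an \<open>m\<close>-th power. Hence \<open>f(k) = v\<^sub>G(k) + 2n + 1\<close> is
  monotone with \<open>f(km) \<le> m f(k)\<close>, so that \<open>f(k)/k\<close> converges to its infimum.\<close>

section \<open>Substitution of monomials\<close>

lemma poly_mapping_eq_sum_single:
  "p = (\<Sum>u\<in>Poly_Mapping.keys p. Poly_Mapping.single u (Poly_Mapping.lookup p u))"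
  by (rule poly_mapping_eqI) (auto simp: lookup_sum lookup_single when_def in_keys_iff)

text \<open>The linear map between monoid algebras induced by a map \<open>h\<close> of the
  exponents; coefficients of exponents with the same image add up.\<close>

definition map_exponents :: "('a \<Rightarrow> 'b) \<Rightarrow> ('a \<Rightarrow>\<^sub>0 'k::comm_ring_1) \<Rightarrow> ('b \<Rightarrow>\<^sub>0 'k)" where
  "map_exponents h p = (\<Sum>u\<in>Poly_Mapping.keys p. Poly_Mapping.single (h u) (Poly_Mapping.lookup p u))"

lemma map_exponents_single [simp]:
  "map_exponents h (Poly_Mapping.single u a) = Poly_Mapping.single (h u) a"
  by (simp add: map_exponents_def)

lemma map_exponents_zero [simp]: "map_exponents h 0 = 0"
  by (simp add: map_exponents_def)

lemma map_exponents_add: "map_exponents h (p + q) = map_exponents h p + map_exponents h q"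
  unfolding map_exponents_def
  by (rule setsum_keys_plus_distrib) (simp_all add: single_add)

lemma map_exponents_diff: "map_exponents h (p - q) = map_exponents h p - map_exponents h q"
  using map_exponents_add[of h "p - q" q] by (simp add: algebra_simps)

lemma map_exponents_sum: "map_exponents h (sum f A) = (\<Sum>x\<in>A. map_exponents h (f x))"
  using sum_comp_morphism[of "map_exponents h" f A] by (simp add: map_exponents_add o_def)

text \<open>Expanding both factors into monomials reduces the claim to products of two monomials,
  where it is additivity of \<open>h\<close>.\<close>

lemma map_exponents_mult:
  fixes p q :: "'a::comm_monoid_add \<Rightarrow>\<^sub>0 'k::comm_ring_1" and h :: "'a \<Rightarrow> 'b::comm_monoid_add"
  assumes h: "\<And>u v. h (u + v) = h u + h v"
  shows "map_exponents h (p * q) = map_exponents h p * map_exponents h q"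
proof -
  have "map_exponents h (p * q) = map_exponents h
      ((\<Sum>u\<in>Poly_Mapping.keys p. Poly_Mapping.single u (Poly_Mapping.lookup p u)) *
       (\<Sum>v\<in>Poly_Mapping.keys q. Poly_Mapping.single v (Poly_Mapping.lookup q v)))"
    using poly_mapping_eq_sum_single[of p] poly_mapping_eq_sum_single[of q] by simp
  also have "\<dots> = map_exponents h p * map_exponents h q"
    by (simp only: sum_product map_exponents_sum mult_single map_exponents_single h
        map_exponents_def[of h p] map_exponents_def[of h q])
  finally show ?thesis .
qed

text \<open>The action on exponent vectors of the substitution \<open>z \<mapsto> (c z)\<^sup>m\<close>.\<close>

definition subst_exponent :: "('a::finite \<Rightarrow> 'b) \<Rightarrow> nat \<Rightarrow> ('a \<Rightarrow>\<^sub>0 nat) \<Rightarrow> ('b \<Rightarrow>\<^sub>0 nat)" where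
  "subst_exponent c m u = (\<Sum>z\<in>UNIV. Poly_Mapping.single (c z) (m * Poly_Mapping.lookup u z))"

lemma subst_exponent_add: "subst_exponent c m (u + v) = subst_exponent c m u + subst_exponent c m v"
  by (simp add: subst_exponent_def lookup_add algebra_simps single_add sum.distrib)

lemma subst_exponent_zero: "subst_exponent c m 0 = 0"
  by (simp add: subst_exponent_def)

lemma subst_exponent_single [simp]:
  "subst_exponent c m (Poly_Mapping.single z k) = Poly_Mapping.single (c z) (m * k)"
proof -
  have "subst_exponent c m (Poly_Mapping.single z k) =
      (\<Sum>w\<in>UNIV. if w = z then Poly_Mapping.single (c z) (m * k) else 0)"
    unfolding subst_exponent_def by (rule sum.cong) (auto simp: lookup_single when_def)
  then show ?thesis by simp
qed

lemma lookup_subst_exponent_id: "Poly_Mapping.lookup (subst_exponent (\<lambda>z. z) m u) z = m * Poly_Mapping.lookup u z"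
  by (simp add: subst_exponent_def lookup_sum lookup_single when_def)

abbreviation subst :: "('a::finite \<Rightarrow> 'b) \<Rightarrow> nat \<Rightarrow> (('a \<Rightarrow>\<^sub>0 nat) \<Rightarrow>\<^sub>0 'k::comm_ring_1) \<Rightarrow> (('b \<Rightarrow>\<^sub>0 nat) \<Rightarrow>\<^sub>0 'k)" where
  "subst c m \<equiv> map_exponents (subst_exponent c m)"

lemma subst_mult: "subst c m (p * q) = subst c m p * subst c m q"
  by (rule map_exponents_mult) (rule subst_exponent_add)


section \<open>Ideals and their powers\<close>

interpretation ideal: module "(*) :: 'a::comm_ring_1 \<Rightarrow> 'a \<Rightarrow> 'a"
  by unfold_locales (simp_all add: algebra_simps)

text \<open>Here \<open>scale_scale\<close> is associativity, oriented against \<open>mult.assoc\<close>.\<close>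

declare ideal.scale_scale [simp del]

lemma ideal_gen_base: "b \<in> B \<Longrightarrow> b \<in> ideal_gen B"
  unfolding ideal_gen_def by (rule ideal.span_base)

lemma ideal_gen_scale: "x \<in> ideal_gen B \<Longrightarrow> c * x \<in> ideal_gen B"
  unfolding ideal_gen_def by (rule ideal.span_scale)

lemma ideal_gen_mono: "B \<subseteq> ideal_gen C \<Longrightarrow> ideal_gen B \<subseteq> ideal_gen C"
  unfolding ideal_gen_def by (rule ideal.span_minimal) auto

text \<open>Only generators need checking, since \<open>f (c * b) = f c * f b\<close> stays in the
  target ideal. This serves both substitutions below, z \<mapsto> z^m and the identification of x_i
  with y_i.\<close>

lemma ideal_gen_image:
  assumes add: "\<And>p q. f (p + q) = f p + f q" and mult: "\<And>p q. f (p * q) = f p * f q"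
    and gens: "\<And>b. b \<in> B \<Longrightarrow> f b \<in> ideal_gen C" and "x \<in> ideal_gen B"
  shows "f x \<in> ideal_gen C"
  using \<open>x \<in> ideal_gen B\<close> unfolding ideal_gen_def
proof (induction rule: ideal.span_induct_alt)
  case base
  have "f 0 = 0" using add[of 0 0] by simp
  then show ?case by (simp add: ideal.span_zero)
next
  case (step c b y)
  then show ?case
    using gens[of b] by (auto simp: add mult ideal_gen_def intro!: ideal.span_add ideal.span_scale)
qed

lemma ideal_sum_ideal_gen: "ideal_sum (ideal_gen A) (ideal_gen B) = ideal_gen (A \<union> B)"
  by (auto simp: ideal_sum_def ideal_gen_def ideal.span_Un)

lemma ideal_mult_ideal_gen:
  "ideal_mult (ideal_gen A) (ideal_gen B) = ideal_gen {a * b | a b. a \<in> A \<and> b \<in> B}" (is "?L = ideal_gen ?AB")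
proof
  \<comment> \<open>Bilinearity is used one factor at a time: here the left factor is still a
    generator, and the next induction frees it.\<close>
  have right: "a * y \<in> ideal_gen ?AB" if "a \<in> A" "y \<in> ideal_gen B" for a y
    using that(2) unfolding ideal_gen_def
  proof (induction rule: ideal.span_induct_alt)
    case base then show ?case by (simp add: ideal.span_zero)
  next
    case (step c b y)
    have "c * (a * b) + a * y \<in> ideal.span ?AB"
      using step that(1) by (blast intro: ideal.span_add ideal.span_scale ideal.span_base)
    then show ?case by (simp add: algebra_simps)
  qed
  have "x * y \<in> ideal_gen ?AB" if "x \<in> ideal_gen A" "y \<in> ideal_gen B" for x y
    using that(1) unfolding ideal_gen_def
  proof (induction rule: ideal.span_induct_alt)
    case base then show ?case by (simp add: ideal.span_zero)
  next
    case (step c a x)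
    have "c * (a * y) + x * y \<in> ideal.span ?AB"
      using step right[OF _ that(2)] unfolding ideal_gen_def
      by (blast intro: ideal.span_add ideal.span_scale)
    then show ?case by (simp add: algebra_simps)
  qed
  then show "?L \<subseteq> ideal_gen ?AB"
    unfolding ideal_mult_def by (intro ideal_gen_mono) auto
  show "ideal_gen ?AB \<subseteq> ?L"
    unfolding ideal_mult_def
    by (rule ideal_gen_mono) (auto simp: ideal_gen_def intro!: ideal.span_base)
qed

text \<open>Each power is itself an ideal, the zeroth being the whole ring, so it absorbs
  multiplication by elements of \<open>I\<close>.\<close>

lemma ideal_power_Suc_subset: "ideal_power I (Suc r) \<subseteq> ideal_power I r"
proof -
  have "\<exists>B. ideal_power I r = ideal_gen B"
  proof (cases r)
    case 0
    then have "ideal_power I r = ideal_gen UNIV" by (simp add: ideal_gen_def)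
    then show ?thesis ..
  qed (auto simp: ideal_mult_def)
  then obtain B where B: "ideal_power I r = ideal_gen B" ..
  show ?thesis
    unfolding ideal_power.simps ideal_mult_def B
    by (rule ideal_gen_mono) (auto simp: ideal_gen_def intro: ideal.span_scale)
qed

lemma ideal_power_antimono: "r \<le> s \<Longrightarrow> ideal_power I s \<subseteq> ideal_power I r"
  using ideal_power_Suc_subset by (rule lift_Suc_antimono_le)


section \<open>Monomials\<close>

lemma UNIV_variable: "UNIV = range X \<union> range Y"
proof -
  have "z \<in> range X \<union> range Y" for z :: "'v variable" by (cases z) auto
  then show ?thesis by auto
qed

instance variable :: (finite) finite
  by standard (simp add: UNIV_variable)

lemma var_power: "var z ^ k = Poly_Mapping.single (Poly_Mapping.single z k) 1"
proof (induction k)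
  case (Suc k)
  have "Poly_Mapping.single z (Suc 0) + Poly_Mapping.single z k = Poly_Mapping.single z (Suc k)"
    by (simp flip: single_add)
  with Suc show ?case by (simp add: var_def mult_single)
qed simp

lemma range_xvar_Un_yvar: "range (\<lambda>i. f (X i)) \<union> range (\<lambda>i. f (Y i)) = range f"
  by (simp add: UNIV_variable image_Un image_image)

definition tdeg :: "('a::finite \<Rightarrow>\<^sub>0 nat) \<Rightarrow> nat" where
  "tdeg u = (\<Sum>z\<in>UNIV. Poly_Mapping.lookup u z)"

lemma tdeg_add: "tdeg (u + v) = tdeg u + tdeg v"
  by (simp add: tdeg_def lookup_add sum.distrib)

lemma tdeg_single [simp]: "tdeg (Poly_Mapping.single z k) = k"
  by (simp add: tdeg_def lookup_single when_def)

lemma single_add_diff: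
  fixes u :: "'a \<Rightarrow>\<^sub>0 nat"
  assumes "k \<le> Poly_Mapping.lookup u z"
  shows "Poly_Mapping.single z k + (u - Poly_Mapping.single z k) = u"
  using assms by (intro poly_mapping_eqI) (auto simp: lookup_add lookup_minus lookup_single when_def)

text \<open>Reduces containment of a power to a test on monomials of degree exactly
  \<open>r\<close>. In the inductive step a monomial of positive degree has a variable with positive
  exponent, which is split off.\<close>

lemma max_ideal_power:
  "ideal_power (max_ideal :: ('v::finite, 'k::field) S set) r =
     ideal_gen {Poly_Mapping.single u 1 | u. tdeg u = r}"
proof (induction r)
  case 0
  have "(1 :: ('v, 'k) S) \<in> {Poly_Mapping.single u 1 | u. tdeg u = 0}"
    by (auto intro!: exI[of _ 0] simp: tdeg_def)
  then have "x * 1 \<in> ideal_gen {Poly_Mapping.single u 1 | u. tdeg u = 0}" for x :: "('v, 'k) S"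
    by (intro ideal_gen_scale ideal_gen_base)
  then show ?case by auto
next
  case (Suc r)
  have monomials: "{a * b | a b. a \<in> range var \<and> b \<in> {Poly_Mapping.single u 1 | u. tdeg u = r}}
      = {Poly_Mapping.single u (1::'k) | u :: 'v variable \<Rightarrow>\<^sub>0 nat. tdeg u = Suc r}" (is "?A = ?B")
  proof
    show "?A \<subseteq> ?B" by (auto simp: var_def mult_single tdeg_add)
    show "?B \<subseteq> ?A"
    proof safe
      fix u :: "'v variable \<Rightarrow>\<^sub>0 nat"
      assume u: "tdeg u = Suc r"
      then obtain z where z: "1 \<le> Poly_Mapping.lookup u z"
        unfolding tdeg_def by (metis One_nat_def Suc_leI gr0I nat.distinct(1) sum.neutral)
      define v where "v = u - Poly_Mapping.single z 1"
      have v: "u = Poly_Mapping.single z 1 + v"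
        unfolding v_def using single_add_diff[OF z] by simp
      then have "tdeg v = r" using u by (simp add: tdeg_add)
      moreover have "Poly_Mapping.single u (1::'k) = var z * Poly_Mapping.single v 1"
        by (simp add: var_def mult_single v)
      ultimately show "\<exists>a b. Poly_Mapping.single u (1::'k) = a * b \<and> a \<in> range var \<and>
          b \<in> {Poly_Mapping.single u 1 | u. tdeg u = r}"
        by blast
    qed
  qed
  have max_ideal: "(max_ideal :: ('v, 'k) S set) = ideal_gen (range var)"
    unfolding max_ideal_def by (simp only: range_xvar_Un_yvar)
  show ?case
    unfolding ideal_power.simps Suc.IH unfolding max_ideal ideal_mult_ideal_gen monomials ..
qed

lemma max_ideal_power_subset_iff:
  "ideal_power (max_ideal :: ('v::finite, 'k::field) S set) r \<subseteq> ideal_gen B \<longleftrightarrow>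
     (\<forall>u. tdeg u = r \<longrightarrow> Poly_Mapping.single u 1 \<in> ideal_gen B)"
  unfolding max_ideal_power
proof
  assume "\<forall>u. tdeg u = r \<longrightarrow> Poly_Mapping.single u 1 \<in> ideal_gen B"
  then show "ideal_gen {Poly_Mapping.single u 1 | u. tdeg u = r} \<subseteq> ideal_gen B"
    by (intro ideal_gen_mono) auto
qed (auto intro: ideal_gen_base)

section \<open>The ideals \<open>(\<mm>\<^bsup>[k]\<^esup>, J\<^sub>G)\<close>\<close>

text \<open>A single generating set for the sum of the two ideals, so that a substitution can be
  tested on both kinds of generators at once.\<close>

definition gens :: "'v::finite set set \<Rightarrow> nat \<Rightarrow> ('v, 'k::field) S set" where
  "gens E k = range (\<lambda>z. var z ^ k) \<union> {xvar i * yvar j - xvar j * yvar i | i j. {i, j} \<in> E}"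

lemma ideal_sum_eq_gens:
  "ideal_sum (max_ideal_bracket k) (binomial_edge_ideal E) = ideal_gen (gens E k)"
  by (simp add: max_ideal_bracket_def binomial_edge_ideal_def ideal_sum_ideal_gen gens_def
      range_xvar_Un_yvar[of "\<lambda>z. var z ^ k"])

lemma monomial_in_gens:
  fixes E :: "'v::finite set set"
  assumes "k \<le> Poly_Mapping.lookup u z"
  shows "(Poly_Mapping.single u 1 :: ('v, 'k::field) S) \<in> ideal_gen (gens E k)"
proof -
  have "Poly_Mapping.single u (1::'k) = Poly_Mapping.single (u - Poly_Mapping.single z k) 1 * var z ^ k"
    using single_add_diff[OF assms] by (simp add: var_power mult_single add.commute)
  moreover have "(var z ^ k :: ('v, 'k) S) \<in> ideal_gen (gens E k)"
    by (auto simp: gens_def intro: ideal_gen_base)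
  ultimately show ?thesis by (simp only: ideal_gen_scale)
qed

lemma ideal_gens_antimono:
  fixes E :: "'v::finite set set"
  assumes "k \<le> l"
  shows "(ideal_gen (gens E l) :: ('v, 'k::field) S set) \<subseteq> ideal_gen (gens E k)"
proof (rule ideal_gen_mono, rule subsetI)
  fix p :: "('v, 'k) S" assume "p \<in> gens E l"
  then consider z where "p = var z ^ l" | "p \<in> gens E k" by (auto simp: gens_def)
  then show "p \<in> ideal_gen (gens E k)"
  proof cases
    case 1
    then show ?thesis
      using monomial_in_gens[of k "Poly_Mapping.single z l" z E] assms by (simp add: var_power)
  next
    case 2
    then show ?thesis by (rule ideal_gen_base)
  qed
qed

text \<open>The substitution plays the role of the Frobenius in arbitrary characteristic: it preserves
  \<open>J\<^sub>G\<close> because \<open>a - b\<close> divides \<open>a\<^sup>m - b\<^sup>m\<close>.\<close>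

lemma subst_power_gens:
  assumes "p \<in> ideal_gen (gens E k)"
  shows "subst (\<lambda>z. z) m p \<in> ideal_gen (gens E (k * m))"
proof (rule ideal_gen_image[OF _ _ _ assms])
  fix b :: "('a, 'b) S" assume "b \<in> gens E k"
  then consider z where "b = var z ^ k"
    | i j where "{i, j} \<in> E" "b = xvar i * yvar j - xvar j * yvar i"
    by (auto simp: gens_def)
  then show "subst (\<lambda>z. z) m b \<in> ideal_gen (gens E (k * m))"
  proof cases
    case 1
    then have "subst (\<lambda>z. z) m b = var z ^ (k * m)" by (simp add: var_power mult.commute)
    then show ?thesis by (auto simp: gens_def intro: ideal_gen_base)
  next
    case 2
    have var: "subst (\<lambda>z. z) m (var z :: ('a, 'b) S) = var z ^ m" for z
      by (simp only: var_power) (simp add: var_def)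
    have "subst (\<lambda>z. z) m b = (xvar i * yvar j) ^ m - (xvar j * yvar i) ^ m"
      by (simp add: 2 map_exponents_diff subst_mult var power_mult_distrib)
    also have "\<dots> = (\<Sum>l<m. (xvar j * yvar i) ^ (m - Suc l) * (xvar i * yvar j) ^ l) * b"
      by (simp add: 2 power_diff_sumr2 mult.commute)
    also have "\<dots> \<in> ideal_gen (gens E (k * m))"
      using 2 by (intro ideal_gen_scale ideal_gen_base) (auto simp: gens_def)
    finally show ?thesis .
  qed
qed (simp_all add: map_exponents_add subst_mult)

section \<open>Powers of the maximal ideal contained in (m^[k], J_G)\<close>

lemma max_ideal_power_subset_mult:
  fixes E :: "'v::finite set set"
  assumes sub: "ideal_power (max_ideal :: ('v, 'k::field) S set) r \<subseteq> ideal_gen (gens E k)"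
    and m: "m \<ge> 1"
  shows "ideal_power (max_ideal :: ('v, 'k) S set) (m * r + CARD('v variable) * (m - 1))
    \<subseteq> ideal_gen (gens E (k * m))"
  unfolding max_ideal_power_subset_iff
proof safe
  fix u :: "'v variable \<Rightarrow>\<^sub>0 nat"
  assume u: "tdeg u = m * r + CARD('v variable) * (m - 1)"
  \<comment> \<open>Division of every exponent by \<open>m\<close> with remainder: the monomial of
    \<open>u\<close> is divisible by the \<open>m\<close>-th power of the monomial of
    \<open>q\<close>.\<close>
  define q where "q = Poly_Mapping.map (\<lambda>a. a div m) u"
  have q: "Poly_Mapping.lookup q z = Poly_Mapping.lookup u z div m" for z
    by (simp add: q_def Poly_Mapping.map.rep_eq when_def)
  \<comment> \<open>Each variable loses at most \<open>m - 1\<close> to its remainder; the summand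
    \<open>CARD('v variable) * (m - 1)\<close> in the degree pays for this and leaves
    \<open>m * r \<le> m * tdeg q\<close>.\<close>
  have "tdeg u \<le> (\<Sum>z\<in>UNIV. m * Poly_Mapping.lookup q z + (m - 1))"
    unfolding tdeg_def
  proof (rule sum_mono)
    fix z
    have "Poly_Mapping.lookup u z mod m \<le> m - 1"
      using m mod_less_divisor[of m "Poly_Mapping.lookup u z"] by linarith
    then show "Poly_Mapping.lookup u z \<le> m * Poly_Mapping.lookup q z + (m - 1)"
      unfolding q by (metis add_left_mono mult_div_mod_eq)
  qed
  also have "\<dots> = m * tdeg q + CARD('v variable) * (m - 1)"
    by (simp add: tdeg_def sum.distrib sum_distrib_left)
  finally have "r \<le> tdeg q" using u m by simp
  then have "ideal_power (max_ideal :: ('v, 'k) S set) (tdeg q) \<subseteq> ideal_gen (gens E k)"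
    using sub ideal_power_antimono by blast
  then have "(Poly_Mapping.single q 1 :: ('v, 'k) S) \<in> ideal_gen (gens E k)"
    unfolding max_ideal_power_subset_iff by blast
  then have power: "Poly_Mapping.single (subst_exponent (\<lambda>z. z) m q) 1
      \<in> (ideal_gen (gens E (k * m)) :: ('v, 'k) S set)"
    using subst_power_gens by (metis map_exponents_single)
  \<comment> \<open>Truncated subtraction is exact here because m * (a div m) \<le> a for every
    exponent a.\<close>
  define v where "v = u - subst_exponent (\<lambda>z. z) m q"
  have "u = v + subst_exponent (\<lambda>z. z) m q"
    by (rule poly_mapping_eqI)
      (simp add: v_def lookup_add lookup_minus lookup_subst_exponent_id q)
  then have "Poly_Mapping.single u (1::'k) =
      Poly_Mapping.single v 1 * Poly_Mapping.single (subst_exponent (\<lambda>z. z) m q) 1"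
    by (simp add: mult_single)
  then show "(Poly_Mapping.single u 1 :: ('v, 'k) S) \<in> ideal_gen (gens E (k * m))"
    using power by (simp only: ideal_gen_scale)
qed

text \<open>Pigeonhole on the exponents. The bound is crude, but it makes the set whose maximum
  defines \<open>v_graph\<close> finite.\<close>

lemma max_ideal_power_subset_bound:
  fixes E :: "'v::finite set set"
  shows "ideal_power (max_ideal :: ('v, 'k::field) S set) (CARD('v variable) * k)
    \<subseteq> ideal_gen (gens E k)"
  unfolding max_ideal_power_subset_iff
proof safe
  fix u :: "'v variable \<Rightarrow>\<^sub>0 nat"
  assume u: "tdeg u = CARD('v variable) * k"
  have "\<exists>z. k \<le> Poly_Mapping.lookup u z"
  proof (rule ccontr)
    assume "\<nexists>z. k \<le> Poly_Mapping.lookup u z"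
    then have "tdeg u < (\<Sum>z\<in>(UNIV :: 'v variable set). k)"
      unfolding tdeg_def by (intro sum_strict_mono) (auto simp: not_le)
    with u show False by simp
  qed
  then show "(Poly_Mapping.single u 1 :: ('v, 'k) S) \<in> ideal_gen (gens E k)"
    using monomial_in_gens by blast
qed

section \<open>Lower bound by identifying x_i with y_i\<close>

primrec vertex :: "'v variable \<Rightarrow> 'v" where
  "vertex (X i) = i"
| "vertex (Y i) = i"

text \<open>In a monomial ideal every monomial in the support of a member is divisible by a
  generator: multiples of a generator have this property, and the support of a sum lies in the union
  of the supports.\<close>

lemma keys_ideal_gen_powers:
  fixes k :: nat
  assumes "p \<in> ideal_gen (range (\<lambda>i. Poly_Mapping.single (Poly_Mapping.single i k) (1::'k::field)))"
    and "u \<in> Poly_Mapping.keys p"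
  shows "\<exists>i. k \<le> Poly_Mapping.lookup u i"
  using assms unfolding ideal_gen_def
proof (induction arbitrary: u rule: ideal.span_induct_alt)
  case (step c b y)
  from step.prems keys_add have "u \<in> Poly_Mapping.keys (c * b) \<or> u \<in> Poly_Mapping.keys y" by fastforce
  then show ?case
  proof
    assume "u \<in> Poly_Mapping.keys (c * b)"
    moreover obtain i where "b = Poly_Mapping.single (Poly_Mapping.single i k) 1" using step.hyps by blast
    ultimately obtain v where "u = v + Poly_Mapping.single i k"
      using keys_mult[of c b] by auto
    then have "k \<le> Poly_Mapping.lookup u i" by (simp add: lookup_add)
    then show ?thesis ..
  qed (rule step.IH)
qed simp

text \<open>The ring map \<open>subst vertex 1\<close> carries the ideal into the one generated by
  the k-th powers of one variable per vertex, but sends the witness to a monomial with all exponents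
  \<open>k - 1\<close>.\<close>

lemma max_ideal_power_not_subset:
  fixes E :: "'v::finite set set"
  assumes "k \<ge> 1"
  shows "\<not> ideal_power (max_ideal :: ('v, 'k::field) S set) (CARD('v) * (k - 1))
    \<subseteq> ideal_gen (gens E k)"
proof
  assume sub: "ideal_power (max_ideal :: ('v, 'k) S set) (CARD('v) * (k - 1)) \<subseteq> ideal_gen (gens E k)"
  define u where "u = (\<Sum>i\<in>(UNIV :: 'v set). Poly_Mapping.single (X i) (k - 1))"
  have tdeg_sum: "tdeg (sum f A) = (\<Sum>i\<in>A. tdeg (f i))" for f :: "'v \<Rightarrow> 'v variable \<Rightarrow>\<^sub>0 nat" and A
    unfolding tdeg_def lookup_sum by (rule sum.swap)
  have "tdeg u = CARD('v) * (k - 1)" by (simp add: u_def tdeg_sum)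
  with sub have "(Poly_Mapping.single u 1 :: ('v, 'k) S) \<in> ideal_gen (gens E k)"
    unfolding max_ideal_power_subset_iff by blast
  then have "subst vertex 1 (Poly_Mapping.single u (1::'k)) \<in>
      ideal_gen (range (\<lambda>i. Poly_Mapping.single (Poly_Mapping.single i k) 1))"
  proof (rule ideal_gen_image[rotated -1])
    fix b :: "('v, 'k) S" assume "b \<in> gens E k"
    then consider z where "b = var z ^ k"
      | i j where "b = xvar i * yvar j - xvar j * yvar i"
      by (auto simp: gens_def)
    then show "subst vertex 1 b \<in> ideal_gen (range (\<lambda>i. Poly_Mapping.single (Poly_Mapping.single i k) 1))"
    proof cases
      case 1
      then show ?thesis by (auto simp: var_power intro: ideal_gen_base)
    next
      case 2
      \<comment> \<open>Both products become the same monomial, the product of the variables at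
        \<open>i\<close> and \<open>j\<close>.\<close>
      then have "subst vertex 1 b = 0"
        by (simp add: map_exponents_diff subst_mult var_def mult.commute)
      then show ?thesis by (simp add: ideal_gen_def ideal.span_zero)
    qed
  qed (simp_all add: map_exponents_add subst_mult)
  then have "\<exists>i. k \<le> Poly_Mapping.lookup (subst_exponent vertex 1 u) i"
    by (rule keys_ideal_gen_powers) simp
  moreover have "Poly_Mapping.lookup (subst_exponent vertex 1 u) i = k - 1" for i
  proof -
    have "subst_exponent vertex 1 u = (\<Sum>i\<in>UNIV. Poly_Mapping.single i (k - 1))"
      using sum_comp_morphism[of "subst_exponent vertex 1" "\<lambda>i. Poly_Mapping.single (X i) (k - 1)" UNIV, symmetric]
      by (simp add: u_def subst_exponent_add subst_exponent_zero o_def)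
    then show ?thesis by (simp add: lookup_sum lookup_single when_def)
  qed
  \<comment> \<open>With \<open>k \<ge> 1\<close> the truncated \<open>k - 1\<close> is strictly
    below \<open>k\<close>; at \<open>k = 0\<close> both would be 0.\<close>
  ultimately show False using assms by auto
qed


section \<open>The threshold\<close>

text \<open>The powers decrease, so the exponents without containment form an initial segment; it is
  nonempty and bounded, hence \<open>Max\<close> is its true end. The later estimates of
  \<open>v_graph\<close> all go through this equivalence.\<close>

lemma ideal_power_subset_iff_v_graph:
  fixes E :: "'v::finite set set"
  assumes "k \<ge> 1"
  shows "ideal_power (max_ideal :: ('v, 'k::field) S set) r \<subseteq> ideal_gen (gens E k)
    \<longleftrightarrow> v_graph TYPE('k) E k < r"
proof -
  let ?P = "\<lambda>r. ideal_power (max_ideal :: ('v, 'k) S set) r \<subseteq> ideal_gen (gens E k)"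
  have v: "v_graph TYPE('k) E k = Max {r. \<not> ?P r}"
    by (simp add: v_graph_def ideal_sum_eq_gens)
  have mono: "?P s" if "?P r" "r \<le> s" for r s
    using that ideal_power_antimono by blast
  have "{r. \<not> ?P r} \<subseteq> {..CARD('v variable) * k}"
    using mono[OF max_ideal_power_subset_bound] nat_le_linear by blast
  then have fin: "finite {r. \<not> ?P r}" by (rule finite_subset) simp
  have "v_graph TYPE('k) E k \<in> {r. \<not> ?P r}"
    unfolding v by (rule Max_in[OF fin]) (use max_ideal_power_not_subset[OF assms] in blast)
  then have "?P r \<Longrightarrow> v_graph TYPE('k) E k < r" using mono by (auto simp: not_le[symmetric])
  moreover have "\<not> ?P r \<Longrightarrow> r \<le> v_graph TYPE('k) E k" unfolding v using fin by simp
  ultimately show ?thesis by fastforce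
qed

lemma v_graph_ge:
  fixes E :: "'v::finite set set"
  assumes "k \<ge> 1"
  shows "CARD('v) * (k - 1) \<le> v_graph TYPE('k::field) E k"
  using max_ideal_power_not_subset[OF assms, of E]
  unfolding ideal_power_subset_iff_v_graph[OF assms] by (rule leI)

section \<open>Existence of the limit\<close>

lemma v_graph_mono:
  assumes "1 \<le> k" "k \<le> l"
  shows "v_graph TYPE('k::field) E k \<le> v_graph TYPE('k) E l"
proof (rule ccontr)
  assume "\<not> ?thesis"
  then have "ideal_power (max_ideal :: ('a, 'k) S set) (v_graph TYPE('k) E k) \<subseteq> ideal_gen (gens E l)"
    using assms by (subst ideal_power_subset_iff_v_graph) auto
  also have "\<dots> \<subseteq> ideal_gen (gens E k)" using assms(2) by (rule ideal_gens_antimono)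
  finally show False using assms(1) by (subst (asm) ideal_power_subset_iff_v_graph) auto
qed

text \<open>The first contained power is \<open>Suc (v_graph TYPE('k) E k)\<close>. Adding
  \<open>CARD('v variable) + 1\<close> to \<open>v_graph\<close> absorbs the error term
  \<open>CARD('v variable) * (m - 1)\<close> and makes the estimate homogeneous in
  \<open>m\<close>.\<close>

lemma v_graph_mult:
  fixes E :: "'v::finite set set"
  assumes "k \<ge> 1" "m \<ge> 1"
  shows "v_graph TYPE('k::field) E (k * m) + CARD('v variable) + 1
    \<le> m * (v_graph TYPE('k) E k + CARD('v variable) + 1)"
proof -
  have "v_graph TYPE('k) E (k * m) < m * Suc (v_graph TYPE('k) E k) + CARD('v variable) * (m - 1)"
    using max_ideal_power_subset_mult[of "Suc (v_graph TYPE('k) E k)" E k m, where 'k='k]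
      ideal_power_subset_iff_v_graph[of k _ E, where 'k='k]
      ideal_power_subset_iff_v_graph[of "k * m" _ E, where 'k='k] assms
    by (simp del: ideal_power.simps)
  then show ?thesis using \<open>m \<ge> 1\<close> by (cases m) (auto simp: algebra_simps)
qed

text \<open>A relative of Fekete's lemma. Rounding l up to a multiple of a fixed k costs only f k /
  l, which vanishes as l grows, so every f k / k bounds the limit superior.\<close>

lemma convergent_submultiplicative:
  fixes f :: "nat \<Rightarrow> real"
  assumes nonneg: "\<And>k. 0 \<le> f k"
    and mono: "\<And>k l. 1 \<le> k \<Longrightarrow> k \<le> l \<Longrightarrow> f k \<le> f l"
    and mult: "\<And>k m. 1 \<le> k \<Longrightarrow> 1 \<le> m \<Longrightarrow> f (k * m) \<le> real m * f k"
  shows "convergent (\<lambda>k. f k / real k)"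
proof -
  define L where "L = (INF k\<in>{1..}. f k / real k)"
  have bdd: "bdd_below ((\<lambda>k. f k / real k) ` {1..})"
    using nonneg by (intro bdd_belowI[of _ 0]) auto
  have upper: "f l / real l \<le> f k / real k + f k / real l" if "1 \<le> k" "1 \<le> l" for k l
  proof -
    have "l < k * Suc (l div k)"
      using dividend_less_div_times[of k l] that by (simp add: algebra_simps)
    then have "f l \<le> f (k * Suc (l div k))" using that by (intro mono) auto
    also have "\<dots> \<le> real (Suc (l div k)) * f k" using that by (intro mult) auto
    also have "\<dots> \<le> (real l / real k + 1) * f k"
      using nonneg by (intro mult_right_mono) (auto simp: of_nat_div_le_of_nat)
    finally have "f l / real l \<le> (real l / real k + 1) * f k / real l"
      by (rule divide_right_mono) simp
    then show ?thesis using that by (simp add: field_simps)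
  qed
  have "(\<lambda>k. f k / real k) \<longlonglongrightarrow> L"
  proof (rule order_tendstoI)
    fix a assume "a < L"
    show "\<forall>\<^sub>F l in sequentially. a < f l / real l"
      using eventually_ge_at_top[of 1]
    proof eventually_elim
      case (elim l)
      then have "L \<le> f l / real l" unfolding L_def by (intro cINF_lower[OF bdd]) auto
      with \<open>a < L\<close> show ?case by simp
    qed
  next
    fix a assume "L < a"
    then obtain k where k: "1 \<le> k" "f k / real k < a"
      unfolding L_def using cINF_less_iff[OF _ bdd] by auto
    have "(\<lambda>l. f k / real k + f k / real l) \<longlonglongrightarrow> f k / real k + 0"
      by (intro tendsto_intros lim_const_over_n)
    then have "\<forall>\<^sub>F l in sequentially. f k / real k + f k / real l < a"
      using k(2) by (intro order_tendstoD) auto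
    then show "\<forall>\<^sub>F l in sequentially. f l / real l < a"
      using eventually_ge_at_top[of 1]
    proof eventually_elim
      case (elim l)
      then show ?case using upper[OF k(1) elim(2)] by simp
    qed
  qed
  then show ?thesis by (rule convergentI)
qed

lemma convergent_v_graph: "convergent (\<lambda>k. real (v_graph TYPE('k::field) (E :: 'v::finite set set) k) / real k)"
proof -
  \<comment> \<open>Only the shifted sequence is submultiplicative; the shift contributes
    \<open>?c / real k\<close>, which converges and is subtracted afterwards.\<close>
  let ?c = "real (CARD('v variable) + 1)"
  have "convergent (\<lambda>k. (real (v_graph TYPE('k) E k) + ?c) / real k)"
  proof (rule convergent_submultiplicative)
    fix k m :: nat assume "1 \<le> k" "1 \<le> m"
    from v_graph_mult[OF this, of E, where 'k='k]
    have "real (v_graph TYPE('k) E (k * m) + CARD('v variable) + 1)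
      \<le> real (m * (v_graph TYPE('k) E k + CARD('v variable) + 1))" by (simp only: of_nat_le_iff)
    then show "real (v_graph TYPE('k) E (k * m)) + ?c \<le> real m * (real (v_graph TYPE('k) E k) + ?c)"
      by (simp add: algebra_simps)
  qed (auto simp: v_graph_mono)
  moreover have "convergent (\<lambda>k. ?c / real k)"
    using lim_const_over_n by (rule convergentI)
  ultimately have "convergent (\<lambda>k. (real (v_graph TYPE('k) E k) + ?c) / real k - ?c / real k)"
    by (rule convergent_diff)
  then show ?thesis by (simp add: add_divide_distrib)
qed

theorem lemma2p4:
  fixes E :: "'v::finite set set"
  assumes "simple_graph E"
  shows "real CARD('v) \<le> diagonal_F_threshold TYPE('k::field) E"
proof (rule LIMSEQ_le)
  show "(\<lambda>k. real (v_graph TYPE('k) E k) / real k) \<longlonglongrightarrow> diagonal_F_threshold TYPE('k) E"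
    unfolding diagonal_F_threshold_def using convergent_v_graph by (simp add: convergent_LIMSEQ_iff)
  \<comment> \<open>The comparison sequence is n(k - 1)/k, the bound of \<open>v_graph_ge\<close>
    divided by k, written as n - n/k.\<close>
  have "(\<lambda>k. real CARD('v) - real CARD('v) / real k) \<longlonglongrightarrow> real CARD('v) - 0"
    by (intro tendsto_intros lim_const_over_n)
  then show "(\<lambda>k. real CARD('v) - real CARD('v) / real k) \<longlonglongrightarrow> real CARD('v)" by simp
  have "real CARD('v) - real CARD('v) / real k \<le> real (v_graph TYPE('k) E k) / real k"
    if "k \<ge> 1" for k
  proof -
    have "real (CARD('v) * (k - 1)) \<le> real (v_graph TYPE('k) E k)"
      using v_graph_ge[OF that] by (simp only: of_nat_le_iff)
    then have "(real CARD('v) * (real k - 1)) / real k \<le> real (v_graph TYPE('k) E k) / real k"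
      using that by (intro divide_right_mono) (simp_all add: of_nat_diff)
    then show ?thesis using that by (simp add: right_diff_distrib diff_divide_distrib)
  qed
  then show "\<exists>N. \<forall>k\<ge>N. real CARD('v) - real CARD('v) / real k \<le> real (v_graph TYPE('k) E k) / real k"
    by blast
qed

end
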